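(* If a partial covariance $K_{\widetilde\Omega}$ on a nearly serrated domain $\widetilde\Omega\subset I\times I$ has a unique completion on $I\times I$, then this completion is canonical, i.e. it belongs to $\mathscr{G}_{\widetilde\Omega}$.
   Context: $I\subset\mathbb{R}$ is an interval. A covariance on a set $S$ is a symmetric function $K:S\times S\to\mathbb{R}$ with $\sum_{i,j=1}^n\alpha_i\alpha_jK(t_i,t_j)\ge 0$ for all $n\ge1$, $t_i\in S$, $\alpha_i\in\mathbb{R}$; $\mathscr{C}$ is the set of covariances on $I$. A symmetric domain is a set $\Omega\subset I\times I$ containing the diagonal with $(s,t)\in\Omega$ iff $(t,s)\in\Omega$. A partial covariance on a symmetric domain $\Omega$ is a function $K_\Omega:\Omega\to\mathbb{R}$ such that $K_\Omega|_{J\times J}$ is a covariance on $J$ whenever $J\subset I$ and $J\times J\subset\Omega$. A completion of $K_\Omega$ is a covariance $K$ on $I$ with $K|_\Omega=K_\Omega$. A serrated domain is $\bigcup_{j=1}^m(I_j\times I_j)$ with $\{I_j\}$ a finite collection of subintervals covering $I$. A (symmetric) domain $\widetilde\Omega\subset I\times I$ is nearly serrated if for every $\epsilon>0$ there are serrated domains $\Omega_\epsilon\subset\widetilde\Omega\subset\Omega^\epsilon$ with $d_H(\widetilde\Omega,\Omega_\epsilon)<\epsilon$ and $d_H(\widetilde\Omega,\Omega^\epsilon)<\epsilon$, where $d_H$ is the Hausdorff distance induced by the Euclidean metric on $\mathbb{R}^2$. A set $J\subset I$ separates $s,t\in I$ in $\Omega$ if for every finite sequence $t_1=s,t_2,\dots,t_r=t$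 in $I$ ($r\ge1$) with $(t_i,t_{i+1})\in\Omega$ for $1\le i<r$, there is $1<j<r$ with $t_j\in J$. Let $$\mathscr{G}_\Omega=\Big\{K\in\mathscr{C}:K(s,t)=\big\langle K(s,\cdot),K(\cdot,t)\big\rangle_{\mathscr{H}(K_J)}\text{ for all }J\subset I\text{ separating }s,t\in I\text{ in }\Omega\Big\},$$ where $K_J=K|_{J\times J}$, $\mathscr{H}(K_J)$ is its reproducing kernel Hilbert space ($\mathscr{H}(K_\emptyset)=\{0\}$), and functions in the inner product are restricted to $J$. A completion $K$ of $K_\Omega$ is called canonical if $K\in\mathscr{G}_\Omega$. *)

theory Defs
  imports "HOL-Analysis.Analysis"
begin

section \<open>Covariances and reproducing kernel Hilbert spaces\<close>

text \<open>Kernels on a set are total functions of which only the values on that set matter.\<close>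

definition covariance_on :: "'a set \<Rightarrow> ('a \<Rightarrow> 'a \<Rightarrow> real) \<Rightarrow> bool" where
  "covariance_on S K \<longleftrightarrow>
     (\<forall>s\<in>S. \<forall>t\<in>S. K s t = K t s) \<and>
     (\<forall>n\<ge>1. \<forall>(t :: nat \<Rightarrow> 'a) (\<alpha> :: nat \<Rightarrow> real). (\<forall>i\<in>{1..n}. t i \<in> S) \<longrightarrow>
        0 \<le> (\<Sum>i=1..n. \<Sum>j=1..n. \<alpha> i * \<alpha> j * K (t i) (t j)))"

text \<open>A function on \<open>S\<close> is represented by its extension by zero, so that pointwise operations
  make the functions on \<open>S\<close> a vector space and there is exactly one function on the empty set.\<close>

definition restr0 :: "'a set \<Rightarrow> ('a \<Rightarrow> real) \<Rightarrow> 'a \<Rightarrow> real" where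
  "restr0 S f = (\<lambda>x. if x \<in> S then f x else 0)"

definition function_space_on :: "'a set \<Rightarrow> ('a \<Rightarrow> real) set \<Rightarrow> bool" where
  "function_space_on S H \<longleftrightarrow>
     (\<forall>f\<in>H. \<forall>x. x \<notin> S \<longrightarrow> f x = 0) \<and>
     (\<lambda>x. 0) \<in> H \<and>
     (\<forall>f\<in>H. \<forall>g\<in>H. (\<lambda>x. f x + g x) \<in> H) \<and>
     (\<forall>c. \<forall>f\<in>H. (\<lambda>x. c * f x) \<in> H)"

definition inner_product_on ::
    "('a \<Rightarrow> real) set \<Rightarrow> (('a \<Rightarrow> real) \<Rightarrow> ('a \<Rightarrow> real) \<Rightarrow> real) \<Rightarrow> bool" where
  "inner_product_on H ip \<longleftrightarrow>
     (\<forall>f\<in>H. \<forall>g\<in>H. ip f g = ip g f) \<and>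
     (\<forall>f\<in>H. \<forall>g\<in>H. \<forall>h\<in>H. ip (\<lambda>x. f x + g x) h = ip f h + ip g h) \<and>
     (\<forall>c. \<forall>f\<in>H. \<forall>g\<in>H. ip (\<lambda>x. c * f x) g = c * ip f g) \<and>
     (\<forall>f\<in>H. 0 \<le> ip f f) \<and>
     (\<forall>f\<in>H. ip f f = 0 \<longrightarrow> f = (\<lambda>x. 0))"

definition ip_dist ::
    "(('a \<Rightarrow> real) \<Rightarrow> ('a \<Rightarrow> real) \<Rightarrow> real) \<Rightarrow> ('a \<Rightarrow> real) \<Rightarrow> ('a \<Rightarrow> real) \<Rightarrow> real" where
  "ip_dist ip f g = sqrt (ip (\<lambda>x. f x - g x) (\<lambda>x. f x - g x))"

definition ip_complete ::
    "('a \<Rightarrow> real) set \<Rightarrow> (('a \<Rightarrow> real) \<Rightarrow> ('a \<Rightarrow> real) \<Rightarrow> real) \<Rightarrow> bool" where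
  "ip_complete H ip \<longleftrightarrow>
     (\<forall>\<phi> :: nat \<Rightarrow> 'a \<Rightarrow> real.
        (\<forall>n. \<phi> n \<in> H) \<and> (\<forall>\<epsilon>>0. \<exists>N. \<forall>m\<ge>N. \<forall>n\<ge>N. ip_dist ip (\<phi> m) (\<phi> n) < \<epsilon>) \<longrightarrow>
        (\<exists>f\<in>H. (\<lambda>n. ip_dist ip (\<phi> n) f) \<longlonglongrightarrow> 0))"

definition is_rkhs :: "'a set \<Rightarrow> ('a \<Rightarrow> 'a \<Rightarrow> real) \<Rightarrow>
    ('a \<Rightarrow> real) set \<times> (('a \<Rightarrow> real) \<Rightarrow> ('a \<Rightarrow> real) \<Rightarrow> real) \<Rightarrow> bool" where
  "is_rkhs S K = (\<lambda>(H, ip).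
     function_space_on S H \<and> inner_product_on H ip \<and> ip_complete H ip \<and>
     (\<forall>t\<in>S. restr0 S (\<lambda>x. K x t) \<in> H) \<and>
     (\<forall>t\<in>S. \<forall>f\<in>H. ip f (restr0 S (\<lambda>x. K x t)) = f t))"

text \<open>By the Moore--Aronszajn theorem such a pair exists whenever \<open>K\<close> is a covariance on \<open>S\<close>, and it
  is unique up to the irrelevant values of the inner product outside the space.\<close>

definition rkhs :: "'a set \<Rightarrow> ('a \<Rightarrow> 'a \<Rightarrow> real) \<Rightarrow>
    ('a \<Rightarrow> real) set \<times> (('a \<Rightarrow> real) \<Rightarrow> ('a \<Rightarrow> real) \<Rightarrow> real)" where
  "rkhs S K = (SOME p. is_rkhs S K p)"

definition rkhs_inner ::
    "'a set \<Rightarrow> ('a \<Rightarrow> 'a \<Rightarrow> real) \<Rightarrow> ('a \<Rightarrow> real) \<Rightarrow> ('a \<Rightarrow> real) \<Rightarrow> real" where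
  "rkhs_inner S K f g = snd (rkhs S K) (restr0 S f) (restr0 S g)"

section \<open>Domains\<close>

definition symmetric_domain :: "real set \<Rightarrow> (real \<times> real) set \<Rightarrow> bool" where
  "symmetric_domain I \<Omega> \<longleftrightarrow>
     \<Omega> \<subseteq> I \<times> I \<and> (\<forall>t\<in>I. (t, t) \<in> \<Omega>) \<and> (\<forall>s t. (s, t) \<in> \<Omega> \<longleftrightarrow> (t, s) \<in> \<Omega>)"

definition serrated_domain :: "real set \<Rightarrow> (real \<times> real) set \<Rightarrow> bool" where
  "serrated_domain I \<Omega> \<longleftrightarrow>
     (\<exists>\<J>. finite \<J> \<and> (\<forall>J\<in>\<J>. is_interval J \<and> J \<subseteq> I) \<and> \<Union>\<J> = I \<and> \<Omega> = (\<Union>J\<in>\<J>. J \<times> J))"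

text \<open>Extended values, since the domains may be unbounded.  The distance on
  \<^typ>\<open>real \<times> real\<close> is the Euclidean one.\<close>

definition hausdorff_distance :: "'a::metric_space set \<Rightarrow> 'a set \<Rightarrow> ennreal" where
  "hausdorff_distance A B =
     max (SUP x\<in>A. INF y\<in>B. ennreal (dist x y)) (SUP y\<in>B. INF x\<in>A. ennreal (dist x y))"

definition nearly_serrated_domain :: "real set \<Rightarrow> (real \<times> real) set \<Rightarrow> bool" where
  "nearly_serrated_domain I \<Omega> \<longleftrightarrow>
     symmetric_domain I \<Omega> \<and>
     (\<forall>\<epsilon>::real. \<epsilon> > 0 \<longrightarrow>
        (\<exists>\<Omega>\<^sub>1 \<Omega>\<^sub>2. serrated_domain I \<Omega>\<^sub>1 \<and> serrated_domain I \<Omega>\<^sub>2 \<and> \<Omega>\<^sub>1 \<subseteq> \<Omega> \<and> \<Omega> \<subseteq> \<Omega>\<^sub>2 \<and>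
           hausdorff_distance \<Omega> \<Omega>\<^sub>1 < ennreal \<epsilon> \<and> hausdorff_distance \<Omega> \<Omega>\<^sub>2 < ennreal \<epsilon>))"

section \<open>Completions\<close>

definition partial_covariance ::
    "real set \<Rightarrow> (real \<times> real) set \<Rightarrow> (real \<Rightarrow> real \<Rightarrow> real) \<Rightarrow> bool" where
  "partial_covariance I \<Omega> K\<^sub>\<Omega> \<longleftrightarrow>
     symmetric_domain I \<Omega> \<and> (\<forall>J. J \<subseteq> I \<and> J \<times> J \<subseteq> \<Omega> \<longrightarrow> covariance_on J K\<^sub>\<Omega>)"

definition is_completion ::
    "real set \<Rightarrow> (real \<times> real) set \<Rightarrow> (real \<Rightarrow> real \<Rightarrow> real) \<Rightarrow> (real \<Rightarrow> real \<Rightarrow> real) \<Rightarrow> bool" where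
  "is_completion I \<Omega> K\<^sub>\<Omega> K \<longleftrightarrow>
     covariance_on I K \<and> (\<forall>(s, t)\<in>\<Omega>. K s t = K\<^sub>\<Omega> s t)"

definition is_unique_completion ::
    "real set \<Rightarrow> (real \<times> real) set \<Rightarrow> (real \<Rightarrow> real \<Rightarrow> real) \<Rightarrow> (real \<Rightarrow> real \<Rightarrow> real) \<Rightarrow> bool" where
  "is_unique_completion I \<Omega> K\<^sub>\<Omega> K \<longleftrightarrow>
     is_completion I \<Omega> K\<^sub>\<Omega> K \<and>
     (\<forall>K'. is_completion I \<Omega> K\<^sub>\<Omega> K' \<longrightarrow> (\<forall>s\<in>I. \<forall>t\<in>I. K' s t = K s t))"

text \<open>The intermediate index is strictly inside the path: end points in \<open>J\<close> do not count.\<close>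

definition separates ::
    "real set \<Rightarrow> (real \<times> real) set \<Rightarrow> real set \<Rightarrow> real \<Rightarrow> real \<Rightarrow> bool" where
  "separates I \<Omega> J s t \<longleftrightarrow>
     (\<forall>r\<ge>1. \<forall>p :: nat \<Rightarrow> real.
        (\<forall>i\<in>{1..r}. p i \<in> I) \<and> p 1 = s \<and> p r = t \<and> (\<forall>i\<in>{1..<r}. (p i, p (Suc i)) \<in> \<Omega>) \<longrightarrow>
        (\<exists>j. 1 < j \<and> j < r \<and> p j \<in> J))"

definition canonical_covariances ::
    "real set \<Rightarrow> (real \<times> real) set \<Rightarrow> (real \<Rightarrow> real \<Rightarrow> real) set" where
  "canonical_covariances I \<Omega> =
     {K. covariance_on I K \<and>
         (\<forall>J s t. J \<subseteq> I \<and> s \<in> I \<and> t \<in> I \<and> separates I \<Omega> J s t \<longrightarrow>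
            K s t = rkhs_inner J K (\<lambda>u. K s u) (\<lambda>u. K u t))}"

definition is_canonical_completion ::
    "real set \<Rightarrow> (real \<times> real) set \<Rightarrow> (real \<Rightarrow> real \<Rightarrow> real) \<Rightarrow> (real \<Rightarrow> real \<Rightarrow> real) \<Rightarrow> bool" where
  "is_canonical_completion I \<Omega> K\<^sub>\<Omega> K \<longleftrightarrow>
     is_completion I \<Omega> K\<^sub>\<Omega> K \<and> K \<in> canonical_covariances I \<Omega>"

end

theory Submission
  imports Defs
begin

text \<open>Suppose that \<open>J\<close> separates \<open>s\<close> and \<open>t\<close>.  If one of them lies in \<open>J\<close>, the required identity is
  the reproducing property.  Otherwise let \<open>C\<close> be the set of points that \<open>s\<close> reaches along \<open>\<Omega>\<close> without
  entering \<open>J\<close>; separation says that \<open>t \<notin> C\<close>, and \<open>\<Omega>\<close> joins a point of \<open>C\<close> to a point outside \<open>C\<close>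
  only if the latter is in \<open>J\<close>.  View \<open>K\<close> as the covariance of a Gaussian process \<open>X\<close>, and write
  \<open>P x y = \<langle>K x, K y\<rangle>\<close>, taken in the space of \<open>K\<close> restricted to \<open>J\<close>.  This \<open>P\<close> is the covariance
  of the part of \<open>X\<close> that \<open>J\<close> predicts, and \<open>K - P\<close> that of the prediction error.  Make the errors in
  \<open>C\<close> independent of those outside \<open>C\<close>: the result is again a covariance (\<open>covariance_on_cut\<close>).  It
  replaces \<open>K x y\<close> by \<open>P x y\<close> when exactly one of \<open>x\<close>, \<open>y\<close> is in \<open>C\<close>.  On the pairs of this kind in
  \<open>\<Omega>\<close>, one point lies in \<open>J\<close>, where the error vanishes, so nothing changes there.  The cut kernel is
  therefore another completion.  By uniqueness it equals \<open>K\<close>, and its value at \<open>(s, t)\<close> is \<open>P s t\<close>.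

  Two facts about reproducing kernel Hilbert spaces carry the argument.  The space must exist, since
  otherwise the inner product selected by choice would be arbitrary (\<open>is_rkhs_rkhs\<close>).  And \<open>P\<close> and
  \<open>K - P\<close> must be positive semidefinite (\<open>quad_screened\<close>), which amounts to saying that restricting a
  combination of kernel functions to \<open>J\<close> lands in the space over \<open>J\<close> and does not increase the norm
  (\<open>restriction_in_rkhs\<close>).  Both rest on one description of the squared norm,
  \<open>\<parallel>f\<parallel>\<^sup>2 = sup {2 * (\<Sum>x. a x * f x) - (\<Sum>x. \<Sum>y. a x * a y * K x y)}\<close> over finitely supported \<open>a\<close>,
  which makes sense for every function and mentions no Hilbert space.\<close>

section \<open>Finitely supported coefficients\<close>

definition fsupp :: "'a set \<Rightarrow> ('a \<Rightarrow> real) set" where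
  "fsupp S = {a. finite {x. a x \<noteq> 0} \<and> {x. a x \<noteq> 0} \<subseteq> S}"

definition lin :: "('a \<Rightarrow> real) \<Rightarrow> ('a \<Rightarrow> real) \<Rightarrow> real" where
  "lin a f = (\<Sum>x | a x \<noteq> 0. a x * f x)"

definition quad :: "('a \<Rightarrow> 'a \<Rightarrow> real) \<Rightarrow> ('a \<Rightarrow> real) \<Rightarrow> ('a \<Rightarrow> real) \<Rightarrow> real" where
  "quad K a b = lin a (\<lambda>x. lin b (K x))"

definition delta :: "'a \<Rightarrow> 'a \<Rightarrow> real" where
  "delta t = (\<lambda>x. if x = t then 1 else 0)"

lemma lin_superset:
  assumes "finite F" "{x. a x \<noteq> 0} \<subseteq> F"
  shows "lin a f = (\<Sum>x\<in>F. a x * f x)"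
  unfolding lin_def using assms by (intro sum.mono_neutral_left) auto

lemma fsupp_combine:
  assumes "a \<in> fsupp S" "b \<in> fsupp S"
  shows "(\<lambda>x. c * a x + d * b x) \<in> fsupp S"
proof -
  have "{x. c * a x + d * b x \<noteq> 0} \<subseteq> {x. a x \<noteq> 0} \<union> {x. b x \<noteq> 0}" by auto
  moreover have "finite ({x. a x \<noteq> 0} \<union> {x. b x \<noteq> 0})" "{x. a x \<noteq> 0} \<union> {x. b x \<noteq> 0} \<subseteq> S"
    using assms by (auto simp: fsupp_def)
  ultimately show ?thesis unfolding fsupp_def mem_Collect_eq by (meson finite_subset subset_trans)
qed

lemma fsupp_mono: "S \<subseteq> T \<Longrightarrow> fsupp S \<subseteq> fsupp T"
  by (auto simp: fsupp_def)

lemma fsupp_zero: "(\<lambda>x. 0) \<in> fsupp S"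
  by (simp add: fsupp_def)

lemma fsupp_delta: "t \<in> S \<Longrightarrow> delta t \<in> fsupp S"
  by (simp add: fsupp_def delta_def)

lemma lin_combine_left:
  assumes "a \<in> fsupp S" "b \<in> fsupp S"
  shows "lin (\<lambda>x. c * a x + d * b x) f = c * lin a f + d * lin b f"
proof -
  let ?F = "{x. a x \<noteq> 0} \<union> {x. b x \<noteq> 0}"
  have F: "finite ?F" using assms by (auto simp: fsupp_def)
  have "lin (\<lambda>x. c * a x + d * b x) f = (\<Sum>x\<in>?F. (c * a x + d * b x) * f x)"
    using F by (intro lin_superset) auto
  also have "\<dots> = c * (\<Sum>x\<in>?F. a x * f x) + d * (\<Sum>x\<in>?F. b x * f x)"
    by (simp add: sum_distrib_left sum.distrib[symmetric] algebra_simps)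
  also have "\<dots> = c * lin a f + d * lin b f"
    using lin_superset[OF F, of a f] lin_superset[OF F, of b f] by auto
  finally show ?thesis .
qed

lemma lin_combine_right: "lin a (\<lambda>x. c * f x + d * g x) = c * lin a f + d * lin a g"
  by (simp add: lin_def sum_distrib_left sum.distrib[symmetric] algebra_simps)

lemma lin_delta: "lin (delta t) f = f t"
  by (simp add: lin_def delta_def)

lemma lin_zero: "lin (\<lambda>x. 0) f = 0"
  by (simp add: lin_def)

lemma lin_cong:
  assumes "a \<in> fsupp S" "\<And>x. x \<in> S \<Longrightarrow> f x = g x"
  shows "lin a f = lin a g"
  using assms by (auto simp: lin_def fsupp_def intro!: sum.cong)

lemma lin_restr0: "a \<in> fsupp S \<Longrightarrow> lin a (restr0 S f) = lin a f"
  by (rule lin_cong) (auto simp: restr0_def)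

lemma quad_combine_left:
  assumes "a \<in> fsupp S" "b \<in> fsupp S"
  shows "quad K (\<lambda>x. c * a x + d * b x) e = c * quad K a e + d * quad K b e"
  using assms by (simp add: quad_def lin_combine_left)

lemma quad_combine_right:
  assumes "a \<in> fsupp S" "b \<in> fsupp S"
  shows "quad K e (\<lambda>x. c * a x + d * b x) = c * quad K e a + d * quad K e b"
  using assms by (simp add: quad_def lin_combine_left lin_combine_right)

lemma quad_superset:
  assumes "finite F" "{x. a x \<noteq> 0} \<subseteq> F" "{x. b x \<noteq> 0} \<subseteq> F"
  shows "quad K a b = (\<Sum>x\<in>F. \<Sum>y\<in>F. a x * b y * K x y)"
  unfolding quad_def using assms
  by (simp add: lin_superset sum_distrib_left algebra_simps)

lemma quad_commute:
  assumes "a \<in> fsupp S" "b \<in> fsupp S" "\<And>s t. s \<in> S \<Longrightarrow> t \<in> S \<Longrightarrow> K s t = K t s"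
  shows "quad K a b = quad K b a"
proof -
  let ?F = "{x. a x \<noteq> 0} \<union> {x. b x \<noteq> 0}"
  have F: "finite ?F" "?F \<subseteq> S" using assms by (auto simp: fsupp_def)
  have "quad K a b = (\<Sum>x\<in>?F. \<Sum>y\<in>?F. a x * b y * K x y)"
    using F by (intro quad_superset) auto
  also have "\<dots> = (\<Sum>y\<in>?F. \<Sum>x\<in>?F. a x * b y * K x y)" by (rule sum.swap)
  also have "\<dots> = (\<Sum>y\<in>?F. \<Sum>x\<in>?F. b y * a x * K y x)"
    by (intro sum.cong refl) (simp add: mult.commute assms(3)[OF subsetD[OF F(2)] subsetD[OF F(2)]])
  also have "\<dots> = quad K b a"
    using F by (intro quad_superset[symmetric]) auto
  finally show ?thesis .
qed

lemma quad_nonneg: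
  assumes "covariance_on S K" "a \<in> fsupp S"
  shows "0 \<le> quad K a a"
proof (cases "{x. a x \<noteq> 0} = {}")
  case True
  then show ?thesis by (simp add: quad_def lin_def)
next
  case False
  let ?F = "{x. a x \<noteq> 0}"
  have F: "finite ?F" "?F \<subseteq> S" using assms by (auto simp: fsupp_def)
  obtain h where h: "bij_betw h {1..card ?F} ?F"
    using ex_bij_betw_nat_finite_1[OF F(1)] by blast
  have n: "1 \<le> card ?F" using F False by (simp add: Suc_leI card_gt_0_iff)
  have hS: "\<forall>i\<in>{1..card ?F}. h i \<in> S" using bij_betwE[OF h] F by blast
  have "0 \<le> (\<Sum>i=1..card ?F. \<Sum>j=1..card ?F. a (h i) * a (h j) * K (h i) (h j))"
    using assms(1)[unfolded covariance_on_def, THEN conjunct2, rule_format, OF n, of h "\<lambda>i. a (h i)"]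
      hS by blast
  also have "\<dots> = (\<Sum>i=1..card ?F. \<Sum>y\<in>?F. a (h i) * a y * K (h i) y)"
    by (intro sum.cong refl sum.reindex_bij_betw[OF h])
  also have "\<dots> = (\<Sum>x\<in>?F. \<Sum>y\<in>?F. a x * a y * K x y)"
    by (rule sum.reindex_bij_betw[OF h])
  also have "\<dots> = quad K a a" using F by (simp add: quad_superset)
  finally show ?thesis .
qed

text \<open>Conversely, positivity on coefficient functions gives positivity on sequences in which points may
  be repeated: add up the coefficients that sit at the same point.\<close>

lemma covariance_onI:
  assumes sym: "\<And>s t. s \<in> S \<Longrightarrow> t \<in> S \<Longrightarrow> K s t = K t s"
    and pos: "\<And>a. a \<in> fsupp S \<Longrightarrow> 0 \<le> quad K a a"
  shows "covariance_on S K"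
  unfolding covariance_on_def
proof (intro conjI ballI allI impI)
  fix n :: nat and t :: "nat \<Rightarrow> 'a" and \<alpha> :: "nat \<Rightarrow> real"
  assume t: "\<forall>i\<in>{1..n}. t i \<in> S"
  let ?F = "t ` {1..n}"
  define a where "a = (\<lambda>x. \<Sum>i | i \<in> {1..n} \<and> t i = x. \<alpha> i)"
  have supp: "{x. a x \<noteq> 0} \<subseteq> ?F"
  proof (rule subsetI, rule ccontr)
    fix x assume x: "x \<in> {x. a x \<noteq> 0}" "x \<notin> ?F"
    then have none: "{i. i \<in> {1..n} \<and> t i = x} = {}" by auto
    have "a x = 0" unfolding a_def none by simp
    then show False using x(1) by simp
  qed
  have "a \<in> fsupp S" using supp t by (auto simp: fsupp_def intro: finite_subset)
  have group: "(\<Sum>i=1..n. \<alpha> i * f (t i)) = (\<Sum>x\<in>?F. a x * f x)" for f :: "'a \<Rightarrow> real"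
  proof -
    have "(\<Sum>x\<in>?F. a x * f x) = (\<Sum>x\<in>?F. \<Sum>i | i \<in> {1..n} \<and> t i = x. \<alpha> i * f (t i))"
      unfolding a_def by (intro sum.cong refl) (simp add: sum_distrib_right)
    also have "\<dots> = (\<Sum>i=1..n. \<alpha> i * f (t i))"
      by (rule sum.group) auto
    finally show ?thesis by simp
  qed
  have "(\<Sum>i=1..n. \<Sum>j=1..n. \<alpha> i * \<alpha> j * K (t i) (t j))
      = (\<Sum>i=1..n. \<alpha> i * (\<Sum>j=1..n. \<alpha> j * K (t i) (t j)))"
    by (simp add: sum_distrib_left mult.assoc)
  also have "\<dots> = (\<Sum>x\<in>?F. a x * (\<Sum>y\<in>?F. a y * K x y))"
    unfolding group by (rule group)
  also have "\<dots> = quad K a a"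
    unfolding quad_def by (simp only: lin_superset[OF _ supp] finite_imageI finite_atLeastAtMost)
  finally show "0 \<le> (\<Sum>i=1..n. \<Sum>j=1..n. \<alpha> i * \<alpha> j * K (t i) (t j))"
    using pos[OF \<open>a \<in> fsupp S\<close>] by simp
qed (use sym in auto)

lemma covariance_on_subset:
  assumes "covariance_on S K" "T \<subseteq> S"
  shows "covariance_on T K"
  using assms unfolding covariance_on_def by blast

lemma covariance_on_sym: "covariance_on S K \<Longrightarrow> s \<in> S \<Longrightarrow> t \<in> S \<Longrightarrow> K s t = K t s"
  by (auto simp: covariance_on_def)

section \<open>Existence of the reproducing kernel Hilbert space\<close>

text \<open>Read \<open>a\<close> as the element \<open>k\<^sub>a = \<Sum>x. a x * K x\<close> of the space to be constructed.  Then
  \<open>lin a f\<close> is \<open>\<langle>f, k\<^sub>a\<rangle>\<close> and \<open>quad K a a\<close> is \<open>\<parallel>k\<^sub>a\<parallel>\<^sup>2\<close>, so the gain is \<open>\<parallel>f\<parallel>\<^sup>2 - \<parallel>f - k\<^sub>a\<parallel>\<^sup>2\<close>.  As the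
  \<open>k\<^sub>a\<close> are to be dense, its supremum has to be \<open>\<parallel>f\<parallel>\<^sup>2\<close>.\<close>

definition gain :: "('a \<Rightarrow> 'a \<Rightarrow> real) \<Rightarrow> ('a \<Rightarrow> real) \<Rightarrow> ('a \<Rightarrow> real) \<Rightarrow> real" where
  "gain K f a = 2 * lin a f - quad K a a"

definition energy :: "'a set \<Rightarrow> ('a \<Rightarrow> 'a \<Rightarrow> real) \<Rightarrow> ('a \<Rightarrow> real) \<Rightarrow> real" where
  "energy S K f = (SUP a\<in>fsupp S. gain K f a)"

definition native_space :: "'a set \<Rightarrow> ('a \<Rightarrow> 'a \<Rightarrow> real) \<Rightarrow> ('a \<Rightarrow> real) set" where
  "native_space S K = {f. (\<forall>x. x \<notin> S \<longrightarrow> f x = 0) \<and> bdd_above (gain K f ` fsupp S)}"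

text \<open>The inner product is recovered from the squared norm by polarisation.\<close>

definition native_ip ::
    "'a set \<Rightarrow> ('a \<Rightarrow> 'a \<Rightarrow> real) \<Rightarrow> ('a \<Rightarrow> real) \<Rightarrow> ('a \<Rightarrow> real) \<Rightarrow> real" where
  "native_ip S K f g = (energy S K (\<lambda>x. f x + g x) - energy S K f - energy S K g) / 2"

lemma gain_zero: "gain K f (\<lambda>x. 0) = 0"
  by (simp add: gain_def quad_def lin_zero)

lemma gain_le_energy:
  assumes "f \<in> native_space S K" "a \<in> fsupp S"
  shows "gain K f a \<le> energy S K f"
  unfolding energy_def using assms by (intro cSUP_upper) (auto simp: native_space_def)

lemma energy_le:
  assumes "\<And>a. a \<in> fsupp S \<Longrightarrow> gain K f a \<le> M"
  shows "energy S K f \<le> M"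
  unfolding energy_def using assms fsupp_zero by (intro cSUP_least) auto

lemma native_spaceI:
  assumes "\<And>x. x \<notin> S \<Longrightarrow> f x = 0" "\<And>a. a \<in> fsupp S \<Longrightarrow> gain K f a \<le> M"
  shows "f \<in> native_space S K"
  using assms by (auto simp: native_space_def bdd_above_def)

lemma native_space_outside: "f \<in> native_space S K \<Longrightarrow> x \<notin> S \<Longrightarrow> f x = 0"
  by (simp add: native_space_def)

lemma energy_nonneg: "f \<in> native_space S K \<Longrightarrow> 0 \<le> energy S K f"
  using gain_le_energy[of f S K "\<lambda>x. 0"] by (simp add: gain_zero fsupp_zero)

text \<open>The discriminant form of the Cauchy--Schwarz argument; it serves both for the squared norm
  defined as a supremum and for an arbitrary reproducing kernel Hilbert space.\<close>

lemma square_le_of_quadratic_nonneg: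
  fixes A B C :: real
  assumes C: "0 \<le> C" and nonneg: "\<And>c. 0 \<le> A - 2 * c * B + c\<^sup>2 * C"
  shows "B\<^sup>2 \<le> A * C"
proof (cases "C = 0")
  case True
  have "B = 0"
  proof (rule ccontr)
    assume "B \<noteq> 0"
    then show False using nonneg[of "(A + 1) / (2 * B)"] True by simp
  qed
  then show ?thesis using True by simp
next
  case False
  have "0 \<le> C * (A - 2 * (B / C) * B + (B / C)\<^sup>2 * C)" using nonneg[of "B / C"] C by simp
  also have "\<dots> = A * C - B\<^sup>2" using False by (simp add: field_simps power2_eq_square)
  finally show ?thesis by simp
qed

context
  fixes S :: "'a set" and K :: "'a \<Rightarrow> 'a \<Rightarrow> real"
  assumes cov: "covariance_on S K"
begin

lemma quad_combine:
  assumes "a \<in> fsupp S" "b \<in> fsupp S"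
  shows "quad K (\<lambda>x. c * a x + d * b x) (\<lambda>x. c * a x + d * b x)
    = c\<^sup>2 * quad K a a + 2 * c * d * quad K a b + d\<^sup>2 * quad K b b"
proof -
  have "quad K b a = quad K a b"
    by (rule quad_commute[OF assms(2,1) covariance_on_sym[OF cov]])
  then show ?thesis
    unfolding quad_combine_left[OF assms] quad_combine_right[OF assms]
    by (simp add: power2_eq_square algebra_simps)
qed

text \<open>The identity \<open>p * \<parallel>u\<parallel>\<^sup>2 + q * \<parallel>v\<parallel>\<^sup>2 = \<parallel>p * u + q * v\<parallel>\<^sup>2 + p * q * \<parallel>u - v\<parallel>\<^sup>2\<close>, valid in every
  inner product space, holds for the gain of arbitrary functions and coefficients.\<close>

lemma gain_convex_combination:
  assumes a: "a \<in> fsupp S" and b: "b \<in> fsupp S"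
    and pq: "p + q = 1"
  shows "p * gain K f a + q * gain K g b
     = gain K (\<lambda>x. p * f x + q * g x) (\<lambda>x. p * a x + q * b x)
       + p * q * gain K (\<lambda>x. f x - g x) (\<lambda>x. a x - b x)"
proof -
  have q: "q = 1 - p" using pq by simp
  have m: "lin c (\<lambda>x. f x - g x) = lin c f - lin c g" for c
    using lin_combine_right[of c 1 f "-1" g] by simp
  have l: "lin (\<lambda>x. a x - b x) h = lin a h - lin b h" for h
    using lin_combine_left[OF a b, of 1 "-1" h] by simp
  have k: "quad K (\<lambda>x. a x - b x) (\<lambda>x. a x - b x) = quad K a a - 2 * quad K a b + quad K b b"
    using quad_combine[OF a b, of 1 "-1"] by simp
  show ?thesis
    unfolding gain_def quad_combine[OF a b] k lin_combine_right lin_combine_left[OF a b] m l q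
    by (simp add: algebra_simps power2_eq_square)
qed

text \<open>The map \<open>(a, b) \<mapsto> (p * a + q * b, a - b)\<close> is a bijection on pairs of coefficients, with inverse
  \<open>(u, v) \<mapsto> (u + q * v, u - p * v)\<close>.  Hence the identity for gains passes to their suprema.  All
  weights are included, and not just \<open>1/2\<close>, because they give homogeneity of the polarised form
  without a continuity argument.\<close>

lemma native_space_convex_combination:
  assumes f: "f \<in> native_space S K" and g: "g \<in> native_space S K"
    and p: "0 < p" and q: "0 < q" and pq: "p + q = 1"
  shows "(\<lambda>x. p * f x + q * g x) \<in> native_space S K" (is "?m \<in> _")
    and "(\<lambda>x. f x - g x) \<in> native_space S K" (is "?d \<in> _")
    and "p * energy S K f + q * energy S K g
      = energy S K (\<lambda>x. p * f x + q * g x) + p * q * energy S K (\<lambda>x. f x - g x)"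
proof -
  let ?N = "energy S K"
  have le: "gain K ?m u + p * q * gain K ?d v \<le> p * ?N f + q * ?N g"
    if u: "u \<in> fsupp S" and v: "v \<in> fsupp S" for u v
  proof -
    (* The preimage of (u, v) under the change of coefficients. *)
    let ?a = "\<lambda>x. 1 * u x + q * v x" and ?b = "\<lambda>x. 1 * u x + (- p) * v x"
    have a: "?a \<in> fsupp S" and b: "?b \<in> fsupp S" using fsupp_combine u v by blast+
    have q': "q = 1 - p" using pq by simp
    have "(\<lambda>x. p * ?a x + q * ?b x) = u" "(\<lambda>x. ?a x - ?b x) = v"
      unfolding q' by (auto simp: algebra_simps)
    then have "gain K ?m u + p * q * gain K ?d v = p * gain K f ?a + q * gain K g ?b"
      using gain_convex_combination[OF a b pq, of f g] by simp
    also have "\<dots> \<le> p * ?N f + q * ?N g"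
      using gain_le_energy[OF f a] gain_le_energy[OF g b] p q by (intro add_mono mult_left_mono) auto
    finally show ?thesis .
  qed
  have pq0: "0 < p * q" using p q by simp
  show m: "?m \<in> native_space S K"
    using le[OF _ fsupp_zero] f g by (intro native_spaceI) (auto simp: gain_zero native_space_def)
  have "gain K ?d v \<le> (p * ?N f + q * ?N g) / (p * q)" if "v \<in> fsupp S" for v
    using le[OF fsupp_zero that] pq0 by (simp add: gain_zero pos_le_divide_eq mult.commute)
  then show d: "?d \<in> native_space S K"
    using f g by (intro native_spaceI) (auto simp: native_space_outside)
  have "?N ?m \<le> p * ?N f + q * ?N g - p * q * gain K ?d v" if "v \<in> fsupp S" for v
    using le[OF _ that] by (intro energy_le) (simp add: le_diff_eq)
  then have "?N ?d \<le> (p * ?N f + q * ?N g - ?N ?m) / (p * q)"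
    using pq0 by (intro energy_le) (simp add: pos_le_divide_eq mult.commute algebra_simps)
  then have A: "?N ?m + p * q * ?N ?d \<le> p * ?N f + q * ?N g"
    using pq0 by (simp add: pos_le_divide_eq mult.commute algebra_simps)
  have ge: "p * gain K f a + q * gain K g b \<le> ?N ?m + p * q * ?N ?d"
    if a: "a \<in> fsupp S" and b: "b \<in> fsupp S" for a b
  proof -
    have u: "(\<lambda>x. p * a x + q * b x) \<in> fsupp S" using fsupp_combine a b by blast
    have v: "(\<lambda>x. a x - b x) \<in> fsupp S" using fsupp_combine[OF a b, of 1 "-1"] by simp
    show ?thesis unfolding gain_convex_combination[OF a b pq]
      using gain_le_energy[OF m u] gain_le_energy[OF d v] pq0 by (intro add_mono mult_left_mono) auto
  qed
  have "?N f \<le> (?N ?m + p * q * ?N ?d - q * gain K g b) / p" if "b \<in> fsupp S" for b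
    using ge[OF _ that] p by (intro energy_le) (simp add: pos_le_divide_eq mult.commute le_diff_eq)
  then have "?N g \<le> (?N ?m + p * q * ?N ?d - p * ?N f) / q"
    using p q by (intro energy_le) (simp add: pos_le_divide_eq mult.commute algebra_simps)
  then have "p * ?N f + q * ?N g \<le> ?N ?m + p * q * ?N ?d"
    using q by (simp add: pos_le_divide_eq mult.commute algebra_simps)
  with A show "p * ?N f + q * ?N g = ?N ?m + p * q * ?N ?d" by simp
qed

lemma native_space_zero: "(\<lambda>x. 0) \<in> native_space S K" "energy S K (\<lambda>x. 0) = 0"
proof -
  have *: "gain K (\<lambda>x. 0) a \<le> 0" if "a \<in> fsupp S" for a
    using quad_nonneg[OF cov that] by (simp add: gain_def lin_def)
  show 1: "(\<lambda>x. 0) \<in> native_space S K" by (rule native_spaceI[OF refl *])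
  have "energy S K (\<lambda>x. 0) \<le> 0" by (rule energy_le[OF *])
  with energy_nonneg[OF 1] show "energy S K (\<lambda>x. 0) = 0" by simp
qed

lemma energy_scale:
  assumes f: "f \<in> native_space S K"
  shows "(\<lambda>x. c * f x) \<in> native_space S K" "energy S K (\<lambda>x. c * f x) = c\<^sup>2 * energy S K f"
proof -
  have le: "(\<lambda>x. c * f x) \<in> native_space S K \<and> energy S K (\<lambda>x. c * f x) \<le> c\<^sup>2 * energy S K f"
    if f: "f \<in> native_space S K" and c: "c \<noteq> 0" for c f
  proof -
    have *: "gain K (\<lambda>x. c * f x) a \<le> c\<^sup>2 * energy S K f" if a: "a \<in> fsupp S" for a
    proof -
      have b: "(\<lambda>x. (1/c) * a x + 0 * a x) \<in> fsupp S" by (rule fsupp_combine[OF a a])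
      have "c\<^sup>2 * gain K f (\<lambda>x. (1/c) * a x + 0 * a x) = gain K (\<lambda>x. c * f x) a"
        unfolding gain_def quad_combine[OF a a] lin_combine_left[OF a a]
        using c lin_combine_right[of a c f 0 f] by (simp add: field_simps power2_eq_square)
      then show ?thesis using mult_left_mono[OF gain_le_energy[OF f b], of "c\<^sup>2"] by simp
    qed
    have "(\<lambda>x. c * f x) \<in> native_space S K"
      by (rule native_spaceI[OF _ *]) (simp_all add: native_space_outside[OF f])
    moreover have "energy S K (\<lambda>x. c * f x) \<le> c\<^sup>2 * energy S K f" by (rule energy_le[OF *])
    ultimately show ?thesis by blast
  qed
  have "(\<lambda>x. c * f x) \<in> native_space S K \<and> energy S K (\<lambda>x. c * f x) = c\<^sup>2 * energy S K f"
  proof (cases "c = 0")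
    case True
    then show ?thesis using native_space_zero by simp
  next
    case False
    have 1: "(\<lambda>x. c * f x) \<in> native_space S K" "energy S K (\<lambda>x. c * f x) \<le> c\<^sup>2 * energy S K f"
      using le[OF f False] by auto
    have "energy S K f \<le> (1/c)\<^sup>2 * energy S K (\<lambda>x. c * f x)"
      using le[OF 1(1), of "1/c"] False by simp
    then have "c\<^sup>2 * energy S K f \<le> energy S K (\<lambda>x. c * f x)"
      using False by (simp add: field_simps)
    then show ?thesis using 1 by simp
  qed
  then show "(\<lambda>x. c * f x) \<in> native_space S K" "energy S K (\<lambda>x. c * f x) = c\<^sup>2 * energy S K f"
    by auto
qed

lemma native_space_add:
  assumes f: "f \<in> native_space S K" and g: "g \<in> native_space S K"
  shows "(\<lambda>x. f x + g x) \<in> native_space S K"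
  using energy_scale(1)[OF native_space_convex_combination(1)[OF f g, of "1/2" "1/2"], of 2]
  by (simp add: algebra_simps)

lemma energy_parallelogram:
  assumes f: "f \<in> native_space S K" and g: "g \<in> native_space S K"
  shows "2 * energy S K f + 2 * energy S K g
    = energy S K (\<lambda>x. f x + g x) + energy S K (\<lambda>x. f x - g x)"
proof -
  have "energy S K (\<lambda>x. 1/2 * (f x + g x)) = (1/2)\<^sup>2 * energy S K (\<lambda>x. f x + g x)"
    by (rule energy_scale(2)[OF native_space_add[OF f g]])
  moreover have "(\<lambda>x. 1/2 * (f x + g x)) = (\<lambda>x. 1/2 * f x + 1/2 * g x)" by (auto simp: algebra_simps)
  ultimately show ?thesis
    using native_space_convex_combination(3)[OF f g, of "1/2" "1/2"] by (simp add: power2_eq_square)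
qed

lemma native_ip_self: "f \<in> native_space S K \<Longrightarrow> native_ip S K f f = energy S K f"
  using energy_scale(2)[of f 2] by (simp add: native_ip_def power2_eq_square)

lemma native_ip_commute: "native_ip S K f g = native_ip S K g f"
  by (simp add: native_ip_def add.commute)

lemma native_ip_minus:
  assumes f: "f \<in> native_space S K" and g: "g \<in> native_space S K"
  shows "native_ip S K (\<lambda>x. - f x) g = - native_ip S K f g"
proof -
  have "energy S K (\<lambda>x. - f x) = energy S K f" using energy_scale(2)[OF f, of "-1"] by simp
  moreover have "(\<lambda>x. - f x + g x) = (\<lambda>x. g x - f x)" by auto
  ultimately show ?thesis using energy_parallelogram[OF g f]
    unfolding native_ip_def by (simp add: add.commute field_simps)
qed

text \<open>Apply the weighted identity to \<open>f + g\<close> and \<open>g\<close>, whose difference is \<open>f\<close>.\<close>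

lemma native_ip_scale_contraction:
  assumes f: "f \<in> native_space S K" and g: "g \<in> native_space S K" and p: "0 < p" "p < 1"
  shows "native_ip S K (\<lambda>x. p * f x) g = p * native_ip S K f g"
proof -
  have "(\<lambda>x. p * (f x + g x) + (1 - p) * g x) = (\<lambda>x. p * f x + g x)"
    by (auto simp: algebra_simps)
  then have "p * energy S K (\<lambda>x. f x + g x) + (1 - p) * energy S K g
    = energy S K (\<lambda>x. p * f x + g x) + p * (1 - p) * energy S K f"
    using native_space_convex_combination(3)[OF native_space_add[OF f g] g, of p "1 - p"] p by simp
  then show ?thesis unfolding native_ip_def energy_scale(2)[OF f]
    by (simp add: field_simps power2_eq_square)
qed

text \<open>A factor larger than one is the inverse of a contraction, and negative factors are reduced to
  positive ones by the parallelogram law.\<close>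

lemma native_ip_scale:
  assumes f: "f \<in> native_space S K" and g: "g \<in> native_space S K"
  shows "native_ip S K (\<lambda>x. c * f x) g = c * native_ip S K f g"
proof -
  have pos: "native_ip S K (\<lambda>x. c * f x) g = c * native_ip S K f g" if c: "0 < c" for c
  proof -
    consider "c < 1" | "c = 1" | "c > 1" by linarith
    then show ?thesis
    proof cases
      case 1
      then show ?thesis using native_ip_scale_contraction[OF f g] c by blast
    next
      case 3
      then have "native_ip S K (\<lambda>x. (1/c) * (c * f x)) g = (1/c) * native_ip S K (\<lambda>x. c * f x) g"
        using c by (intro native_ip_scale_contraction energy_scale(1) f g) auto
      then show ?thesis using c by (simp add: field_simps)
    qed simp
  qed
  consider "c > 0" | "c = 0" | "- c > 0" by linarith
  then show ?thesis
  proof cases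
    case 2
    then show ?thesis using native_space_zero by (simp add: native_ip_def)
  next
    case 3
    then show ?thesis
      using native_ip_minus[OF energy_scale(1)[OF f, of "-c"] g] pos[OF 3] by simp
  qed (rule pos)
qed

text \<open>Jordan and von Neumann: subtract the parallelogram law for \<open>f\<close>, \<open>g\<close> from the one for \<open>f + h\<close>,
  \<open>g + h\<close>.\<close>

lemma native_ip_add:
  assumes f: "f \<in> native_space S K" and g: "g \<in> native_space S K" and h: "h \<in> native_space S K"
  shows "native_ip S K (\<lambda>x. f x + g x) h = native_ip S K f h + native_ip S K g h"
proof -
  have h2: "(\<lambda>x. 2 * h x) \<in> native_space S K" "energy S K (\<lambda>x. 2 * h x) = 4 * energy S K h"
    using energy_scale[OF h, of 2] by auto
  have eq: "(\<lambda>x. (f x + h x) + (g x + h x)) = (\<lambda>x. (f x + g x) + 2 * h x)"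
    "(\<lambda>x. (f x + h x) - (g x + h x)) = (\<lambda>x. f x - g x)" by auto
  have "native_ip S K (\<lambda>x. 2 * h x) (\<lambda>x. f x + g x) = 2 * native_ip S K h (\<lambda>x. f x + g x)"
    by (rule native_ip_scale[OF h native_space_add[OF f g]])
  then have "native_ip S K (\<lambda>x. f x + g x) (\<lambda>x. 2 * h x) = 2 * native_ip S K (\<lambda>x. f x + g x) h"
    by (simp only: native_ip_commute)
  then show ?thesis
    using energy_parallelogram[OF f g] h2(2)
      energy_parallelogram[OF native_space_add[OF f h] native_space_add[OF g h]]
    unfolding native_ip_def eq by (simp add: field_simps)
qed

text \<open>Adding a kernel function to \<open>f\<close> only translates the coefficients and adds a constant, so the
  energy of the sum is explicit.  The reproducing property is read off from it.\<close>

lemma gain_kernel_shift: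
  assumes t: "t \<in> S" and a: "a \<in> fsupp S"
  shows "gain K (\<lambda>x. f x + restr0 S (\<lambda>x. K x t) x) a
    = gain K f (\<lambda>x. a x - delta t x) + 2 * f t + K t t"
proof -
  have d: "delta t \<in> fsupp S" by (rule fsupp_delta[OF t])
  have "lin a (\<lambda>x. f x + restr0 S (\<lambda>x. K x t) x) = lin a f + quad K a (delta t)"
    using lin_combine_right[of a 1 f 1 "restr0 S (\<lambda>x. K x t)"] lin_restr0[OF a]
    by (simp add: quad_def lin_delta)
  moreover have "lin (\<lambda>x. a x - delta t x) f = lin a f - f t"
    using lin_combine_left[OF a d, of 1 "-1" f] by (simp add: lin_delta)
  moreover have "quad K (\<lambda>x. a x - delta t x) (\<lambda>x. a x - delta t x)
      = quad K a a - 2 * quad K a (delta t) + K t t"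
    using quad_combine[OF a d, of 1 "-1"] by (simp add: quad_def lin_delta)
  ultimately show ?thesis by (simp add: gain_def)
qed

lemma native_space_kernel_shift:
  assumes t: "t \<in> S" and f: "f \<in> native_space S K"
  shows "(\<lambda>x. f x + restr0 S (\<lambda>x. K x t) x) \<in> native_space S K" (is "?g \<in> _")
    and "energy S K (\<lambda>x. f x + restr0 S (\<lambda>x. K x t) x) = energy S K f + 2 * f t + K t t"
proof -
  have d: "delta t \<in> fsupp S" by (rule fsupp_delta[OF t])
  have le: "gain K ?g a \<le> energy S K f + 2 * f t + K t t" if a: "a \<in> fsupp S" for a
  proof -
    have "(\<lambda>x. a x - delta t x) \<in> fsupp S" using fsupp_combine[OF a d, of 1 "-1"] by simp
    then show ?thesis using gain_kernel_shift[OF t a, of f] gain_le_energy[OF f] by simp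
  qed
  show g: "?g \<in> native_space S K"
    by (rule native_spaceI[OF _ le]) (simp_all add: native_space_outside[OF f] restr0_def)
  have "energy S K f \<le> energy S K ?g - 2 * f t - K t t"
  proof (rule energy_le)
    fix a assume a: "a \<in> fsupp S"
    have b: "(\<lambda>x. a x + delta t x) \<in> fsupp S" using fsupp_combine[OF a d, of 1 1] by simp
    show "gain K f a \<le> energy S K ?g - 2 * f t - K t t"
      using gain_le_energy[OF g b] gain_kernel_shift[OF t b, of f] by simp
  qed
  then show "energy S K ?g = energy S K f + 2 * f t + K t t"
    using energy_le[OF le] by fastforce
qed

lemma native_space_kernel:
  assumes t: "t \<in> S"
  shows "restr0 S (\<lambda>x. K x t) \<in> native_space S K" "energy S K (restr0 S (\<lambda>x. K x t)) = K t t"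
  using native_space_kernel_shift[OF t native_space_zero(1)] native_space_zero(2) by auto

lemma native_ip_reproducing:
  assumes "t \<in> S" "f \<in> native_space S K"
  shows "native_ip S K f (restr0 S (\<lambda>x. K x t)) = f t"
  unfolding native_ip_def using native_space_kernel_shift(2)[OF assms] native_space_kernel(2)[OF assms(1)]
  by simp

lemma kernel_diag_nonneg: "t \<in> S \<Longrightarrow> 0 \<le> K t t"
  using quad_nonneg[OF cov fsupp_delta, of t] by (simp add: quad_def lin_delta)

text \<open>Moving an almost optimal \<open>a\<close> in the direction of a point mass at \<open>t\<close> gains almost nothing.  So
  the value at \<open>t\<close> of the approximation by \<open>a\<close> is close to that of \<open>f\<close>.\<close>

lemma residual_square_le:
  assumes f: "\<And>b. b \<in> fsupp S \<Longrightarrow> gain K f b \<le> M" and a: "a \<in> fsupp S" and t: "t \<in> S"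
  shows "(f t - lin a (K t))\<^sup>2 \<le> (M - gain K f a) * K t t"
proof (rule square_le_of_quadratic_nonneg[OF kernel_diag_nonneg[OF t]])
  fix c :: real
  have d: "delta t \<in> fsupp S" by (rule fsupp_delta[OF t])
  have "quad K a (delta t) = lin a (K t)"
    unfolding quad_def lin_delta using covariance_on_sym[OF cov _ t]
    by (intro lin_cong[OF a]) blast
  then have "gain K f (\<lambda>x. 1 * a x + c * delta t x)
      = gain K f a + 2 * c * (f t - lin a (K t)) - c\<^sup>2 * K t t"
    unfolding gain_def quad_combine[OF a d] lin_combine_left[OF a d]
    by (simp add: lin_delta quad_def algebra_simps)
  then show "0 \<le> M - gain K f a - 2 * c * (f t - lin a (K t)) + c\<^sup>2 * K t t"
    using f[OF fsupp_combine[OF a d, of 1 c]] by simp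
qed

lemma eval_square_le:
  assumes f: "f \<in> native_space S K" and t: "t \<in> S"
  shows "(f t)\<^sup>2 \<le> energy S K f * K t t"
  using residual_square_le[OF gain_le_energy[OF f] fsupp_zero t] by (simp add: lin_zero gain_zero)

lemma ip_dist_native:
  assumes "f \<in> native_space S K" "g \<in> native_space S K"
  shows "ip_dist (native_ip S K) f g = sqrt (energy S K (\<lambda>x. f x - g x))"
    "(\<lambda>x. f x - g x) \<in> native_space S K"
proof -
  show "(\<lambda>x. f x - g x) \<in> native_space S K"
    using native_space_convex_combination(2)[OF assms, of "1/2" "1/2"] by simp
  then show "ip_dist (native_ip S K) f g = sqrt (energy S K (\<lambda>x. f x - g x))"
    by (simp add: ip_dist_def native_ip_self)
qed

text \<open>Evaluations are bounded, so a Cauchy sequence converges pointwise.  For fixed \<open>a\<close> the gain involves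
  finitely many values of the function, so bounds on the gain survive the pointwise limit.  Being
  uniform in \<open>a\<close>, they are bounds on the energy.\<close>

lemma native_complete: "ip_complete (native_space S K) (native_ip S K)"
  unfolding ip_complete_def
proof (intro allI impI, elim conjE)
  fix \<phi> :: "nat \<Rightarrow> 'a \<Rightarrow> real"
  let ?H = "native_space S K" and ?N = "energy S K"
  assume \<phi>: "\<forall>n. \<phi> n \<in> ?H"
    and "\<forall>\<epsilon>>0. \<exists>N. \<forall>m\<ge>N. \<forall>n\<ge>N. ip_dist (native_ip S K) (\<phi> m) (\<phi> n) < \<epsilon>"
  then have cauchy: "\<exists>N. \<forall>m\<ge>N. \<forall>n\<ge>N. sqrt (?N (\<lambda>x. \<phi> m x - \<phi> n x)) < \<epsilon>" if "\<epsilon> > 0" for \<epsilon>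
    using that by (simp add: ip_dist_native)
  have dH: "(\<lambda>x. \<phi> m x - \<phi> n x) \<in> ?H" for m n using ip_dist_native(2) \<phi> by blast
  have conv: "convergent (\<lambda>n. \<phi> n x)" for x
  proof (cases "x \<in> S")
    case True
    have "Cauchy (\<lambda>n. \<phi> n x)"
    proof (rule metric_CauchyI)
      fix e :: real assume e: "e > 0"
      have Kx: "0 \<le> K x x" by (rule kernel_diag_nonneg[OF True])
      define \<delta> where "\<delta> = e / (sqrt (K x x) + 1)"
      have \<delta>: "\<delta> > 0" unfolding \<delta>_def using e Kx by (simp add: add_nonneg_pos)
      obtain N where N: "\<forall>m\<ge>N. \<forall>n\<ge>N. sqrt (?N (\<lambda>x. \<phi> m x - \<phi> n x)) < \<delta>"
        using cauchy[OF \<delta>] by blast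
      have "dist (\<phi> m x) (\<phi> n x) < e" if "m \<ge> N" "n \<ge> N" for m n
      proof -
        have "\<bar>\<phi> m x - \<phi> n x\<bar> \<le> sqrt (?N (\<lambda>x. \<phi> m x - \<phi> n x)) * sqrt (K x x)"
          using real_sqrt_le_mono[OF eval_square_le[OF dH[of m n] True]]
          by (simp add: real_sqrt_mult)
        also have "\<dots> \<le> \<delta> * sqrt (K x x)" using N that Kx by (simp add: mult_right_mono less_imp_le)
        also have "\<dots> < \<delta> * (sqrt (K x x) + 1)" using \<delta> by simp
        also have "\<dots> = e" unfolding \<delta>_def using Kx
          by (smt (verit) nonzero_eq_divide_eq real_sqrt_ge_zero)
        finally show ?thesis by (simp add: dist_real_def)
      qed
      then show "\<exists>N. \<forall>m\<ge>N. \<forall>n\<ge>N. dist (\<phi> m x) (\<phi> n x) < e" by blast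
    qed
    then show ?thesis by (simp add: Cauchy_convergent_iff)
  next
    case False
    then have "(\<lambda>n. \<phi> n x) = (\<lambda>n. 0)" using \<phi> by (auto simp: native_space_def)
    then show ?thesis by (simp add: convergent_const)
  qed
  define f where "f = (\<lambda>x. lim (\<lambda>n. \<phi> n x))"
  have lim: "(\<lambda>n. \<phi> n x) \<longlonglongrightarrow> f x" for x
    unfolding f_def using conv[of x] by (simp add: convergent_LIMSEQ_iff)
  have f0: "f x = 0" if "x \<notin> S" for x
  proof -
    have "(\<lambda>n. \<phi> n x) = (\<lambda>n. 0)" using \<phi> that by (auto simp: native_space_def)
    then show ?thesis unfolding f_def by simp
  qed
  have est: "\<exists>N. \<forall>m\<ge>N. \<forall>a\<in>fsupp S. gain K (\<lambda>x. \<phi> m x - f x) a \<le> \<epsilon>\<^sup>2" if \<epsilon>: "\<epsilon> > 0" for \<epsilon>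
  proof -
    obtain N where N: "\<forall>m\<ge>N. \<forall>n\<ge>N. sqrt (?N (\<lambda>x. \<phi> m x - \<phi> n x)) < \<epsilon>"
      using cauchy[OF \<epsilon>] by blast
    have "gain K (\<lambda>x. \<phi> m x - f x) a \<le> \<epsilon>\<^sup>2" if m: "m \<ge> N" and a: "a \<in> fsupp S" for m a
    proof (rule LIMSEQ_le_const2)
      show "(\<lambda>n. gain K (\<lambda>x. \<phi> m x - \<phi> n x) a) \<longlonglongrightarrow> gain K (\<lambda>x. \<phi> m x - f x) a"
        unfolding gain_def lin_def[of _ "\<lambda>x. _ x - _ x"] by (intro tendsto_intros lim)
      have "gain K (\<lambda>x. \<phi> m x - \<phi> n x) a \<le> \<epsilon>\<^sup>2" if "n \<ge> N" for n
      proof -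
        have "sqrt (?N (\<lambda>x. \<phi> m x - \<phi> n x)) \<le> \<epsilon>" using N m that by (simp add: less_imp_le)
        then have "?N (\<lambda>x. \<phi> m x - \<phi> n x) \<le> \<epsilon>\<^sup>2" using sqrt_le_D by blast
        then show ?thesis using gain_le_energy[OF dH a, of m n] by simp
      qed
      then show "\<exists>N. \<forall>n\<ge>N. gain K (\<lambda>x. \<phi> m x - \<phi> n x) a \<le> \<epsilon>\<^sup>2" by blast
    qed
    then show ?thesis by blast
  qed
  obtain N where "\<forall>m\<ge>N. \<forall>a\<in>fsupp S. gain K (\<lambda>x. \<phi> m x - f x) a \<le> 1\<^sup>2" using est[of 1] by auto
  then have "(\<lambda>x. \<phi> N x - f x) \<in> ?H" using f0 native_space_outside[OF \<phi>[rule_format, of N]]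
    by (intro native_spaceI[where M = 1]) simp_all
  then have "(\<lambda>x. \<phi> N x - (\<phi> N x - f x)) \<in> ?H" using ip_dist_native(2) \<phi> by blast
  then have fH: "f \<in> ?H" by simp
  have "(\<lambda>n. ip_dist (native_ip S K) (\<phi> n) f) \<longlonglongrightarrow> 0"
  proof (rule LIMSEQ_I)
    fix r :: real assume r: "0 < r"
    obtain N where N: "\<forall>m\<ge>N. \<forall>a\<in>fsupp S. gain K (\<lambda>x. \<phi> m x - f x) a \<le> (r/2)\<^sup>2"
      using est[of "r/2"] r by auto
    have "norm (ip_dist (native_ip S K) (\<phi> n) f - 0) < r" if "n \<ge> N" for n
    proof -
      have "?N (\<lambda>x. \<phi> n x - f x) \<le> (r/2)\<^sup>2" using N that by (intro energy_le) blast
      then have "sqrt (?N (\<lambda>x. \<phi> n x - f x)) \<le> r/2" using r by (intro real_le_lsqrt) auto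
      moreover have "0 \<le> ?N (\<lambda>x. \<phi> n x - f x)" using energy_nonneg ip_dist_native(2) \<phi> fH by blast
      ultimately show ?thesis using ip_dist_native(1)[of "\<phi> n" f] \<phi> fH r by simp
    qed
    then show "\<exists>no. \<forall>n\<ge>no. norm (ip_dist (native_ip S K) (\<phi> n) f - 0) < r" by blast
  qed
  with fH show "\<exists>f\<in>?H. (\<lambda>n. ip_dist (native_ip S K) (\<phi> n) f) \<longlonglongrightarrow> 0" by blast
qed

lemma native_is_rkhs: "is_rkhs S K (native_space S K, native_ip S K)"
proof -
  have "f = (\<lambda>x. 0)" if f: "f \<in> native_space S K" and 0: "native_ip S K f f = 0" for f
  proof
    fix x
    show "f x = 0"
    proof (cases "x \<in> S")
      case True
      show ?thesis using eval_square_le[OF f True] 0 native_ip_self[OF f] by simp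
    qed (use f in \<open>auto simp: native_space_def\<close>)
  qed
  then have "inner_product_on (native_space S K) (native_ip S K)"
    unfolding inner_product_on_def
    by (intro conjI ballI allI impI native_ip_commute native_ip_add native_ip_scale)
      (simp_all add: native_ip_self energy_nonneg)
  moreover have "function_space_on S (native_space S K)"
    unfolding function_space_on_def
    by (intro conjI ballI allI impI native_space_zero(1) native_space_add energy_scale(1))
      (rule native_space_outside)
  ultimately show ?thesis unfolding is_rkhs_def
    using native_complete native_space_kernel(1) native_ip_reproducing by simp
qed

text \<open>The Moore--Aronszajn theorem, with the native space as the witness that makes the choice proper.\<close>

lemma is_rkhs_rkhs: "is_rkhs S K (rkhs S K)"
  unfolding rkhs_def by (rule someI) (rule native_is_rkhs)

end

section \<open>Functions of finite energy lie in every reproducing kernel Hilbert space\<close>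

lemma function_space_onD:
  assumes "function_space_on S H"
  shows "(\<lambda>x. 0) \<in> H"
    and "f \<in> H \<Longrightarrow> g \<in> H \<Longrightarrow> (\<lambda>x. f x + g x) \<in> H"
    and "f \<in> H \<Longrightarrow> (\<lambda>x. c * f x) \<in> H"
  using assms by (simp_all add: function_space_on_def)

lemma inner_product_onD:
  assumes "inner_product_on H ip"
  shows "f \<in> H \<Longrightarrow> g \<in> H \<Longrightarrow> ip f g = ip g f"
    and "f \<in> H \<Longrightarrow> g \<in> H \<Longrightarrow> h \<in> H \<Longrightarrow> ip (\<lambda>x. f x + g x) h = ip f h + ip g h"
    and "f \<in> H \<Longrightarrow> g \<in> H \<Longrightarrow> ip (\<lambda>x. c * f x) g = c * ip f g"
    and "f \<in> H \<Longrightarrow> 0 \<le> ip f f"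
  using assms unfolding inner_product_on_def by simp_all

lemma ip_sum:
  assumes H: "function_space_on S H" and ip: "inner_product_on H ip"
    and F: "finite F" "\<And>x. x \<in> F \<Longrightarrow> f x \<in> H"
  shows "(\<lambda>y. \<Sum>x\<in>F. c x * f x y) \<in> H"
    and "g \<in> H \<Longrightarrow> ip (\<lambda>y. \<Sum>x\<in>F. c x * f x y) g = (\<Sum>x\<in>F. c x * ip (f x) g)"
proof -
  note zero = function_space_onD(1)[OF H]
  have "(\<lambda>y. \<Sum>x\<in>F. c x * f x y) \<in> H \<and>
    (g \<in> H \<longrightarrow> ip (\<lambda>y. \<Sum>x\<in>F. c x * f x y) g = (\<Sum>x\<in>F. c x * ip (f x) g))"
    using F
  proof (induction F rule: finite_induct)
    case empty
    have "ip (\<lambda>y. 0 * 0) g = 0 * ip (\<lambda>y. 0) g" if "g \<in> H"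
      by (rule inner_product_onD(3)[OF ip zero that])
    then show ?case using zero by simp
  next
    case (insert z F)
    have fz: "(\<lambda>y. c z * f z y) \<in> H" using insert.prems by (intro function_space_onD(3)[OF H]) auto
    have IH: "(\<lambda>y. \<Sum>x\<in>F. c x * f x y) \<in> H"
      "g \<in> H \<longrightarrow> ip (\<lambda>y. \<Sum>x\<in>F. c x * f x y) g = (\<Sum>x\<in>F. c x * ip (f x) g)"
      using insert.IH insert.prems by auto
    have "(\<lambda>y. c z * f z y + (\<Sum>x\<in>F. c x * f x y)) \<in> H"
      by (rule function_space_onD(2)[OF H fz IH(1)])
    moreover have "ip (\<lambda>y. c z * f z y + (\<Sum>x\<in>F. c x * f x y)) g
        = c z * ip (f z) g + (\<Sum>x\<in>F. c x * ip (f x) g)" if g: "g \<in> H"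
    proof -
      have "ip (\<lambda>y. c z * f z y + (\<Sum>x\<in>F. c x * f x y)) g
          = ip (\<lambda>y. c z * f z y) g + ip (\<lambda>y. \<Sum>x\<in>F. c x * f x y) g"
        by (rule inner_product_onD(2)[OF ip fz IH(1) g])
      moreover have "ip (\<lambda>y. c z * f z y) g = c z * ip (f z) g"
        using insert.prems g by (intro inner_product_onD(3)[OF ip]) auto
      ultimately show ?thesis using IH(2) g by simp
    qed
    ultimately show ?case using insert.hyps by simp
  qed
  then show "(\<lambda>y. \<Sum>x\<in>F. c x * f x y) \<in> H"
    "g \<in> H \<Longrightarrow> ip (\<lambda>y. \<Sum>x\<in>F. c x * f x y) g = (\<Sum>x\<in>F. c x * ip (f x) g)" by auto
qed

lemma ip_diff_scaled:
  assumes H: "function_space_on S H" and ip: "inner_product_on H ip"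
    and f: "f \<in> H" and g: "g \<in> H"
  shows "(\<lambda>x. f x - c * g x) \<in> H"
    and "ip (\<lambda>x. f x - c * g x) (\<lambda>x. f x - c * g x) = ip f f - 2 * c * ip f g + c\<^sup>2 * ip g g"
proof -
  let ?h = "\<lambda>x. - c * g x"
  have h: "?h \<in> H" by (rule function_space_onD(3)[OF H g])
  have eq: "(\<lambda>x. f x - c * g x) = (\<lambda>x. f x + ?h x)" by auto
  show d: "(\<lambda>x. f x - c * g x) \<in> H" unfolding eq by (rule function_space_onD(2)[OF H f h])
  have hk: "ip ?h k = - c * ip g k" if "k \<in> H" for k
    by (rule inner_product_onD(3)[OF ip g that])
  have dk: "ip (\<lambda>x. f x - c * g x) k = ip f k - c * ip g k" if "k \<in> H" for k
  proof -
    have "ip (\<lambda>x. f x + ?h x) k = ip f k + ip ?h k"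
      by (rule inner_product_onD(2)[OF ip f h that])
    then show ?thesis unfolding eq using hk[OF that] by simp
  qed
  note comm = inner_product_onD(1)[OF ip]
  show "ip (\<lambda>x. f x - c * g x) (\<lambda>x. f x - c * g x) = ip f f - 2 * c * ip f g + c\<^sup>2 * ip g g"
    using dk[OF d] comm[OF f d] comm[OF g d] dk[OF f] dk[OF g] comm[OF f g]
    by (simp add: algebra_simps power2_eq_square)
qed

context
  fixes S :: "'a set" and K :: "'a \<Rightarrow> 'a \<Rightarrow> real" and H ip
  assumes rk: "is_rkhs S K (H, ip)"
begin

lemma rkhs_space: "function_space_on S H" "inner_product_on H ip" "ip_complete H ip"
  using rk by (auto simp: is_rkhs_def)

lemma rkhs_ip_commute: "f \<in> H \<Longrightarrow> g \<in> H \<Longrightarrow> ip f g = ip g f"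
  by (rule inner_product_onD(1)[OF rkhs_space(2)])

lemma rkhs_ip_nonneg: "f \<in> H \<Longrightarrow> 0 \<le> ip f f"
  by (rule inner_product_onD(4)[OF rkhs_space(2)])

lemma rkhs_kernel: "t \<in> S \<Longrightarrow> restr0 S (\<lambda>x. K x t) \<in> H"
  using rk by (auto simp: is_rkhs_def)

lemma rkhs_reproducing: "t \<in> S \<Longrightarrow> f \<in> H \<Longrightarrow> ip f (restr0 S (\<lambda>x. K x t)) = f t"
  using rk by (auto simp: is_rkhs_def)

lemma rkhs_kernel_combination:
  assumes a: "a \<in> fsupp S"
  shows "restr0 S (\<lambda>y. lin a (K y)) \<in> H"
    and "f \<in> H \<Longrightarrow> ip f (restr0 S (\<lambda>y. lin a (K y))) = lin a f"
proof -
  let ?F = "{x. a x \<noteq> 0}"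
  have F: "finite ?F" "?F \<subseteq> S" using a by (auto simp: fsupp_def)
  have eq: "restr0 S (\<lambda>y. lin a (K y)) = (\<lambda>y. \<Sum>x\<in>?F. a x * restr0 S (\<lambda>y. K y x) y)"
    by (auto simp: restr0_def lin_def)
  have k: "restr0 S (\<lambda>y. K y x) \<in> H" if "x \<in> ?F" for x using F that by (intro rkhs_kernel) auto
  show in_H: "restr0 S (\<lambda>y. lin a (K y)) \<in> H"
    unfolding eq by (rule ip_sum(1)[OF rkhs_space(1,2) F(1)]) (rule k)
  assume f: "f \<in> H"
  have "ip f (restr0 S (\<lambda>y. lin a (K y))) = ip (restr0 S (\<lambda>y. lin a (K y))) f"
    by (rule rkhs_ip_commute[OF f in_H])
  also have "\<dots> = (\<Sum>x\<in>?F. a x * ip (restr0 S (\<lambda>y. K y x)) f)"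
    unfolding eq by (rule ip_sum(2)[OF rkhs_space(1,2) F(1) _ f]) (rule k)
  also have "\<dots> = lin a f"
    unfolding lin_def using rkhs_ip_commute[OF k f] rkhs_reproducing[OF _ f] F(2)
    by (intro sum.cong refl) auto
  finally show "ip f (restr0 S (\<lambda>y. lin a (K y))) = lin a f" .
qed

lemma rkhs_eval_square_le:
  assumes h: "h \<in> H" and t: "t \<in> S"
  shows "(h t)\<^sup>2 \<le> ip h h * K t t"
proof (rule square_le_of_quadratic_nonneg)
  let ?k = "restr0 S (\<lambda>x. K x t)"
  have kk: "ip ?k ?k = K t t"
    using rkhs_reproducing[OF t rkhs_kernel[OF t]] t by (simp add: restr0_def)
  then show "0 \<le> K t t" using rkhs_ip_nonneg[OF rkhs_kernel[OF t]] by simp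
  fix c :: real
  from kk show "0 \<le> ip h h - 2 * c * h t + c\<^sup>2 * K t t"
    using rkhs_ip_nonneg[OF ip_diff_scaled(1)[OF rkhs_space(1,2) h rkhs_kernel[OF t]], of c]
      ip_diff_scaled(2)[OF rkhs_space(1,2) h rkhs_kernel[OF t], of c]
      rkhs_reproducing[OF t h] by simp
qed

text \<open>Take coefficients whose gains tend to the energy of \<open>f\<close>.  By the midpoint identity the
  corresponding combinations of kernel functions form a Cauchy sequence in \<open>H\<close>.  Its limit agrees with
  \<open>f\<close> at every point, because both evaluations are controlled.  The bound on the norm
  follows from \<open>\<parallel>f\<parallel>\<^sup>2 = \<parallel>f - k\<^sub>a\<parallel>\<^sup>2 + gain K f a\<close>.  The lemma applies to the space selected by
  choice, of which only the defining properties are known.\<close>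

lemma finite_energy_in_rkhs:
  assumes cov: "covariance_on S K"
    and f0: "\<And>x. x \<notin> S \<Longrightarrow> f x = 0" and M: "\<And>a. a \<in> fsupp S \<Longrightarrow> gain K f a \<le> M"
  shows "f \<in> H" "ip f f \<le> M"
proof -
  let ?N = "energy S K f"
  have f: "f \<in> native_space S K" using f0 M by (rule native_spaceI)
  have "\<exists>a\<in>fsupp S. ?N - inverse (real (Suc n)) < gain K f a" for n
    using f fsupp_zero unfolding energy_def native_space_def
    by (subst less_cSUP_iff[symmetric]) auto
  then obtain a where a: "a n \<in> fsupp S" and gap: "?N - inverse (real (Suc n)) < gain K f (a n)" for n
    by metis
  define k where "k n = restr0 S (\<lambda>y. lin (a n) (K y))" for n
  have kH: "k n \<in> H" and kip: "h \<in> H \<Longrightarrow> ip h (k n) = lin (a n) h" for n h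
    unfolding k_def using rkhs_kernel_combination[OF a] by auto
  have kk: "ip (k m) (k n) = quad K (a n) (a m)" for m n
    unfolding kip[OF kH] unfolding k_def quad_def lin_restr0[OF a] ..
  have diff: "ip (\<lambda>x. h x - k n x) (\<lambda>x. h x - k n x) = ip h h - 2 * lin (a n) h + quad K (a n) (a n)"
    "(\<lambda>x. h x - k n x) \<in> H" if "h \<in> H" for h n
    using ip_diff_scaled[OF rkhs_space(1,2) that kH, of 1] kip[OF that] kk by auto
  have kdist: "ip (\<lambda>x. k m x - k n x) (\<lambda>x. k m x - k n x)
      \<le> 2 * inverse (real (Suc m)) + 2 * inverse (real (Suc n))" for m n
  proof -
    have mid: "(\<lambda>x. 1/2 * a m x + 1/2 * a n x) \<in> fsupp S" by (rule fsupp_combine[OF a a])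
    have z: "gain K (\<lambda>x. f x - f x) b = - quad K b b" for b by (simp add: gain_def lin_def)
    have ff: "(\<lambda>x. 1/2 * f x + 1/2 * f x) = f" by auto
    have "1/2 * gain K f (a m) + 1/2 * gain K f (a n)
        = gain K f (\<lambda>x. 1/2 * a m x + 1/2 * a n x)
          - 1/4 * quad K (\<lambda>x. a m x - a n x) (\<lambda>x. a m x - a n x)"
      using gain_convex_combination[OF cov a[of m] a[of n], of "1/2" "1/2" f f] unfolding z ff by simp
    then have "quad K (\<lambda>x. a m x - a n x) (\<lambda>x. a m x - a n x)
        \<le> 4 * ?N - 2 * gain K f (a m) - 2 * gain K f (a n)"
      using gain_le_energy[OF f mid] by simp
    moreover have "quad K (\<lambda>x. a m x - a n x) (\<lambda>x. a m x - a n x)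
        = quad K (a m) (a m) - 2 * quad K (a m) (a n) + quad K (a n) (a n)"
      using quad_combine[OF cov a[of m] a[of n], of 1 "-1"] by simp
    moreover have "quad K (a m) (a n) = quad K (a n) (a m)"
      by (rule quad_commute[OF a a covariance_on_sym[OF cov]])
    ultimately show ?thesis
      using diff(1)[OF kH, of m n] kip[OF kH, of m n] kk[of m m] kk[of m n] gap[of m] gap[of n] by simp
  qed
  have "\<exists>N. \<forall>m\<ge>N. \<forall>n\<ge>N. ip_dist ip (k m) (k n) < \<epsilon>" if \<epsilon>: "\<epsilon> > 0" for \<epsilon>
  proof -
    obtain N where N: "inverse (real (Suc N)) < \<epsilon>\<^sup>2 / 4" using reals_Archimedean[of "\<epsilon>\<^sup>2/4"] \<epsilon> by auto
    have "ip_dist ip (k m) (k n) < \<epsilon>" if "m \<ge> N" "n \<ge> N" for m n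
    proof -
      have "inverse (real (Suc j)) < \<epsilon>\<^sup>2 / 4" if "j \<ge> N" for j
        using N that by (smt (verit) inverse_le_iff_le of_nat_0_less_iff of_nat_le_iff Suc_le_mono zero_less_Suc)
      from this[OF \<open>m \<ge> N\<close>] this[OF \<open>n \<ge> N\<close>]
      have "ip (\<lambda>x. k m x - k n x) (\<lambda>x. k m x - k n x) < \<epsilon>\<^sup>2" using kdist[of m n] by simp
      then show ?thesis unfolding ip_dist_def using \<epsilon> by (intro real_less_lsqrt) auto
    qed
    then show ?thesis by blast
  qed
  then obtain g where g: "g \<in> H" and lim: "(\<lambda>n. ip_dist ip (k n) g) \<longlonglongrightarrow> 0"
    using rkhs_space(3) kH unfolding ip_complete_def by blast
  (* The squared distance of the approximations to their limit g; once f = g is known it measures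
     the norm of f against the gains. *)
  define d where "d n = ip (\<lambda>x. g x - k n x) (\<lambda>x. g x - k n x)" for n
  have "(\<lambda>n. (ip_dist ip (k n) g)\<^sup>2) \<longlonglongrightarrow> 0" using tendsto_power[OF lim, of 2] by simp
  moreover have "(ip_dist ip (k n) g)\<^sup>2 = d n" for n
  proof -
    have "ip (\<lambda>x. k n x - g x) (\<lambda>x. k n x - g x) = d n" "(\<lambda>x. k n x - g x) \<in> H"
      using ip_diff_scaled[OF rkhs_space(1,2) kH g, of n 1] diff(1)[OF g, of n]
        rkhs_ip_commute[OF kH g] kip[OF g] kk unfolding d_def by auto
    then show ?thesis unfolding ip_dist_def using rkhs_ip_nonneg by fastforce
  qed
  ultimately have d: "d \<longlonglongrightarrow> 0" by simp
  have "f = g"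
  proof
    fix t
    show "f t = g t"
    proof (cases "t \<in> S")
      case True
      have small: "(\<lambda>n. k n t) \<longlonglongrightarrow> h t"
        if e: "e \<longlonglongrightarrow> 0" and le: "\<And>n. (h t - k n t)\<^sup>2 \<le> e n * K t t" for e :: "nat \<Rightarrow> real" and h
      proof -
        have "(\<lambda>n. (h t - k n t)\<^sup>2) \<longlonglongrightarrow> 0"
          by (rule tendsto_sandwich[where f = "\<lambda>_. 0" and h = "\<lambda>n. e n * K t t"])
            (use le tendsto_mult_right[OF e, of "K t t"] in auto)
        then have "(\<lambda>n. h t - k n t) \<longlonglongrightarrow> 0"
          using tendsto_real_sqrt by (fastforce simp: tendsto_rabs_zero_iff)
        then have "(\<lambda>n. h t - (h t - k n t)) \<longlonglongrightarrow> h t - 0"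
          by (intro tendsto_intros)
        then show ?thesis by simp
      qed
      have "(\<lambda>n. k n t) \<longlonglongrightarrow> g t"
        by (rule small[OF d]) (use rkhs_eval_square_le[OF diff(2)[OF g] True] in \<open>simp add: d_def\<close>)
      moreover have "(\<lambda>n. k n t) \<longlonglongrightarrow> f t"
      proof (rule small[OF LIMSEQ_inverse_real_of_nat])
        fix n
        have Kt: "0 \<le> K t t" by (rule kernel_diag_nonneg[OF cov True])
        have "(f t - k n t)\<^sup>2 \<le> (?N - gain K f (a n)) * K t t"
          unfolding k_def using residual_square_le[OF cov gain_le_energy[OF f] a True] True
          by (simp add: restr0_def)
        also have "\<dots> \<le> inverse (real (Suc n)) * K t t"
          using gap[of n] Kt by (intro mult_right_mono) auto
        finally show "(f t - k n t)\<^sup>2 \<le> inverse (real (Suc n)) * K t t" .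
      qed
      ultimately show ?thesis using LIMSEQ_unique by blast
    next
      case False
      then show ?thesis using f0 g rkhs_space(1) by (simp add: function_space_on_def)
    qed
  qed
  with g show fH: "f \<in> H" by simp
  have "ip f f \<le> d n + M" for n
    using diff(1)[OF fH, of n] M[OF a[of n]] \<open>f = g\<close> by (simp add: d_def gain_def)
  moreover have "(\<lambda>n. d n + M) \<longlonglongrightarrow> 0 + M" by (intro tendsto_intros d)
  ultimately show "ip f f \<le> M" by (intro LIMSEQ_le_const[of "\<lambda>n. d n + M"]) auto
qed

end

section \<open>Cutting a covariance along a separating set\<close>

text \<open>The covariance of the orthogonal projections of the process onto the closed span of its values
  on \<open>J\<close>.\<close>

definition screened :: "'a set \<Rightarrow> ('a \<Rightarrow> 'a \<Rightarrow> real) \<Rightarrow> 'a \<Rightarrow> 'a \<Rightarrow> real" where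
  "screened J K x y = rkhs_inner J K (\<lambda>u. K x u) (\<lambda>u. K u y)"

text \<open>The covariance that results when, given the values on \<open>J\<close>, the process on \<open>C\<close> is made
  independent of the process outside \<open>C\<close>.\<close>

definition cut :: "'a set \<Rightarrow> ('a \<Rightarrow> 'a \<Rightarrow> real) \<Rightarrow> 'a set \<Rightarrow> 'a \<Rightarrow> 'a \<Rightarrow> real" where
  "cut J K C x y = (if x \<in> C \<longleftrightarrow> y \<in> C then K x y else screened J K x y)"

context
  fixes I J :: "'a set" and K :: "'a \<Rightarrow> 'a \<Rightarrow> real"
  assumes cov: "covariance_on I K" and JI: "J \<subseteq> I"
begin

lemma covariance_on_subindex: "covariance_on J K"
  using cov JI by (rule covariance_on_subset)

text \<open>For \<open>b\<close> supported in \<open>J\<close>, the gain of the restricted combination is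
  \<open>quad K a a - quad K (b - a) (b - a)\<close>, which is bounded by \<open>quad K a a\<close>.\<close>

lemma restriction_in_rkhs:
  assumes rk: "is_rkhs J K (H, ip)" and a: "a \<in> fsupp I"
  shows "restr0 J (\<lambda>y. lin a (K y)) \<in> H" (is "?f \<in> _")
    and "ip (restr0 J (\<lambda>y. lin a (K y))) (restr0 J (\<lambda>y. lin a (K y))) \<le> quad K a a"
proof -
  have le: "gain K ?f b \<le> quad K a a" if b: "b \<in> fsupp J" for b
  proof -
    have bI: "b \<in> fsupp I" using b fsupp_mono[OF JI] by blast
    have "0 \<le> quad K (\<lambda>x. 1 * b x + (-1) * a x) (\<lambda>x. 1 * b x + (-1) * a x)"
      by (rule quad_nonneg[OF cov fsupp_combine[OF bI a]])
    then show ?thesis unfolding quad_combine[OF cov bI a] gain_def lin_restr0[OF b]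
      by (simp add: quad_def)
  qed
  have z: "\<And>x. x \<notin> J \<Longrightarrow> ?f x = 0" by (simp add: restr0_def)
  show "?f \<in> H" "ip ?f ?f \<le> quad K a a"
    using finite_energy_in_rkhs[OF rk covariance_on_subindex z le] by auto
qed

lemma restricted_kernel_in_rkhs:
  assumes rk: "is_rkhs J K (H, ip)" and x: "x \<in> I"
  shows "restr0 J (\<lambda>u. K u x) \<in> H"
  using restriction_in_rkhs(1)[OF rk fsupp_delta[OF x]] by (simp add: lin_delta)

lemma screened_eq:
  assumes "rkhs J K = (H, ip)" "x \<in> I"
  shows "screened J K x y = ip (restr0 J (\<lambda>u. K u x)) (restr0 J (\<lambda>u. K u y))"
proof -
  have "restr0 J (\<lambda>u. K x u) = restr0 J (\<lambda>u. K u x)"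
    using covariance_on_sym[OF cov assms(2)] JI by (auto simp: restr0_def fun_eq_iff)
  then show ?thesis by (simp add: screened_def rkhs_inner_def assms(1))
qed

lemma rkhs_pair:
  obtains H ip where "rkhs J K = (H, ip)" "is_rkhs J K (H, ip)"
  using is_rkhs_rkhs[OF covariance_on_subindex] by (metis surj_pair)

lemma screened_sym:
  assumes "x \<in> I" "y \<in> I"
  shows "screened J K x y = screened J K y x"
proof -
  obtain H ip where H: "rkhs J K = (H, ip)" "is_rkhs J K (H, ip)" by (rule rkhs_pair)
  show ?thesis
    unfolding screened_eq[OF H(1) assms(1)] screened_eq[OF H(1) assms(2)]
    by (rule rkhs_ip_commute[OF H(2)]) (use restricted_kernel_in_rkhs[OF H(2)] assms in auto)
qed

lemma screened_reproducing:
  assumes x: "x \<in> I" and y: "y \<in> J"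
  shows "screened J K x y = K x y"
proof -
  obtain H ip where H: "rkhs J K = (H, ip)" "is_rkhs J K (H, ip)" by (rule rkhs_pair)
  have "screened J K x y = restr0 J (\<lambda>u. K u x) y"
    unfolding screened_eq[OF H(1) x]
    by (rule rkhs_reproducing[OF H(2) y restricted_kernel_in_rkhs[OF H(2) x]])
  then show ?thesis using x y JI covariance_on_sym[OF cov] by (auto simp: restr0_def)
qed

text \<open>\<open>quad (screened J K) a a\<close> is the squared norm of the restriction to \<open>J\<close> of the combination of kernel
  functions given by \<open>a\<close>.\<close>

lemma quad_screened:
  assumes a: "a \<in> fsupp I"
  shows "0 \<le> quad (screened J K) a a" "quad (screened J K) a a \<le> quad K a a"
proof -
  obtain H ip where H: "rkhs J K = (H, ip)" "is_rkhs J K (H, ip)" by (rule rkhs_pair)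
  note sp = rkhs_space(1,2)[OF H(2)]
  let ?F = "{x. a x \<noteq> 0}" and ?e = "\<lambda>x. restr0 J (\<lambda>u. K u x)"
    and ?f = "restr0 J (\<lambda>y. lin a (K y))"
  have F: "finite ?F" "?F \<subseteq> I" using a by (auto simp: fsupp_def)
  have e: "?e x \<in> H" if "x \<in> I" for x using restricted_kernel_in_rkhs[OF H(2) that] .
  have f: "?f \<in> H" by (rule restriction_in_rkhs(1)[OF H(2) a])
  have eq: "?f = (\<lambda>y. \<Sum>x\<in>?F. a x * ?e x y)" by (auto simp: restr0_def lin_def)
  have fg: "ip ?f g = (\<Sum>x\<in>?F. a x * ip (?e x) g)" if "g \<in> H" for g
    unfolding eq by (rule ip_sum(2)[OF sp F(1) _ that]) (use e F in blast)
  have "quad (screened J K) a a = (\<Sum>x\<in>?F. a x * (\<Sum>y\<in>?F. a y * ip (?e x) (?e y)))"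
    unfolding quad_def lin_def using F by (intro sum.cong refl) (auto simp: screened_eq[OF H(1)])
  also have "\<dots> = (\<Sum>x\<in>?F. a x * ip ?f (?e x))"
    using F fg e rkhs_ip_commute[OF H(2)] by (intro sum.cong refl) (simp add: subset_iff)
  also have "\<dots> = ip ?f ?f"
    using F fg[OF f] rkhs_ip_commute[OF H(2) f] e by (simp add: subset_iff)
  finally have q: "quad (screened J K) a a = ip ?f ?f" .
  show "0 \<le> quad (screened J K) a a" unfolding q by (rule rkhs_ip_nonneg[OF H(2) f])
  show "quad (screened J K) a a \<le> quad K a a" unfolding q by (rule restriction_in_rkhs(2)[OF H(2) a])
qed

text \<open>The cut kernel is \<open>P\<close> plus the two diagonal blocks, over \<open>C\<close> and over its complement, of \<open>K - P\<close>.\<close>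

lemma covariance_on_cut: "covariance_on I (cut J K C)"
proof (rule covariance_onI)
  show "cut J K C s t = cut J K C t s" if "s \<in> I" "t \<in> I" for s t
    using that screened_sym covariance_on_sym[OF cov] by (auto simp: cut_def)
next
  fix a assume a: "a \<in> fsupp I"
  let ?F = "{x. a x \<noteq> 0}" and ?P = "screened J K"
  define b where "b = (\<lambda>x. if x \<in> C then a x else 0)"
  define c where "c = (\<lambda>x. if x \<in> C then 0 else a x)"
  have F: "finite ?F" "?F \<subseteq> I" using a by (auto simp: fsupp_def)
  have bF: "{x. b x \<noteq> 0} \<subseteq> ?F" and cF: "{x. c x \<noteq> 0} \<subseteq> ?F" by (auto simp: b_def c_def)
  have b: "b \<in> fsupp I" and c: "c \<in> fsupp I"
    using bF cF F unfolding fsupp_def by (auto intro: finite_subset)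
  have "quad (cut J K C) a a = (\<Sum>x\<in>?F. \<Sum>y\<in>?F. a x * a y * cut J K C x y)"
    using F by (simp add: quad_superset)
  also have "\<dots> = (\<Sum>x\<in>?F. \<Sum>y\<in>?F. a x * a y * ?P x y
      + (b x * b y * K x y - b x * b y * ?P x y) + (c x * c y * K x y - c x * c y * ?P x y))"
    by (intro sum.cong refl) (auto simp: cut_def b_def c_def)
  also have "\<dots> = quad ?P a a + (quad K b b - quad ?P b b) + (quad K c c - quad ?P c c)"
    by (simp add: quad_superset[OF F(1) order_refl order_refl] quad_superset[OF F(1) bF bF]
        quad_superset[OF F(1) cF cF] sum.distrib sum_subtractf)
  also have "\<dots> \<ge> 0" using quad_screened[OF a] quad_screened[OF b] quad_screened[OF c] by simp
  finally show "0 \<le> quad (cut J K C) a a" .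
qed

end

text \<open>A connection inside \<open>I - J\<close> would be a path none of whose points is in \<open>J\<close>.\<close>

lemma separates_components:
  assumes sep: "separates I \<Omega> J s t" and s: "s \<in> I - J" and t: "t \<in> I - J"
  shows "(s, t) \<notin> (\<Omega> \<inter> (I - J) \<times> (I - J))\<^sup>*"
proof
  let ?E = "\<Omega> \<inter> (I - J) \<times> (I - J)"
  assume "(s, t) \<in> ?E\<^sup>*"
  then obtain n where "(s, t) \<in> ?E ^^ n" using rtrancl_imp_relpow by blast
  then obtain f where f: "f 0 = s" "f n = t" "\<forall>i<n. (f i, f (Suc i)) \<in> ?E"
    unfolding relpow_fun_conv by blast
  have f_in: "f i \<in> I - J" if "i \<le> n" for i
    using that f s t by (cases "i = n") auto
  (* Powers of a relation index their paths from 0, separation from 1. *)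
  let ?p = "\<lambda>i. f (i - 1)"
  have "\<forall>i\<in>{1..Suc n}. ?p i \<in> I" using f_in by auto
  moreover have "\<forall>i\<in>{1..<Suc n}. (?p i, ?p (Suc i)) \<in> \<Omega>"
  proof
    fix i assume "i \<in> {1..<Suc n}"
    then have "i - 1 < n" "Suc (i - 1) = i" by auto
    then show "(?p i, ?p (Suc i)) \<in> \<Omega>" using f(3) by (metis IntD1 diff_Suc_1)
  qed
  moreover have "?p 1 = s" "?p (Suc n) = t" using f by auto
  ultimately obtain j where "1 < j" "j < Suc n" "?p j \<in> J"
    using sep[unfolded separates_def, rule_format, of "Suc n" ?p] by auto
  moreover have "j - 1 \<le> n" using \<open>j < Suc n\<close> by arith
  ultimately show False using f_in by blast
qed

theorem theorem8p3:
  fixes I :: "real set" and \<Omega> :: "(real \<times> real) set"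
    and K\<^sub>\<Omega> K :: "real \<Rightarrow> real \<Rightarrow> real"
  assumes "is_interval I"
    and "nearly_serrated_domain I \<Omega>"
    and "partial_covariance I \<Omega> K\<^sub>\<Omega>"
    and "is_unique_completion I \<Omega> K\<^sub>\<Omega> K"
  shows "is_canonical_completion I \<Omega> K\<^sub>\<Omega> K"
proof -
  have compl: "is_completion I \<Omega> K\<^sub>\<Omega> K"
    and uniq: "\<And>K' s t. is_completion I \<Omega> K\<^sub>\<Omega> K' \<Longrightarrow> s \<in> I \<Longrightarrow> t \<in> I \<Longrightarrow> K' s t = K s t"
    using assms(4) by (auto simp: is_unique_completion_def)
  have cov: "covariance_on I K" using compl by (simp add: is_completion_def)
  have \<Omega>: "\<Omega> \<subseteq> I \<times> I" "\<And>s t. (s, t) \<in> \<Omega> \<Longrightarrow> (t, s) \<in> \<Omega>"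
    using assms(3) by (auto simp: partial_covariance_def symmetric_domain_def)
  have "K s t = screened J K s t"
    if J: "J \<subseteq> I" and s: "s \<in> I" and t: "t \<in> I" and sep: "separates I \<Omega> J s t" for J s t
  proof -
    consider "t \<in> J" | "s \<in> J" | "s \<in> I - J" "t \<in> I - J" using s t by blast
    then show ?thesis
    proof cases
      case 1
      then show ?thesis using screened_reproducing[OF cov J s] by simp
    next
      case 2
      then show ?thesis
        using screened_reproducing[OF cov J t] screened_sym[OF cov J s t]
          covariance_on_sym[OF cov s t] by simp
    next
      case 3
      let ?E = "\<Omega> \<inter> (I - J) \<times> (I - J)"
      (* The connected component of s after J is removed. *)
      define C where "C = {x. (s, x) \<in> ?E\<^sup>*}"
      have step: "y \<in> C" if "x \<in> C" "(x, y) \<in> \<Omega>" "x \<notin> J" "y \<notin> J" for x y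
        using that \<Omega>(1) unfolding C_def by (auto intro: rtrancl_into_rtrancl)
      have CJ: "x \<notin> J" if "x \<in> C" for x
        using that 3 unfolding C_def mem_Collect_eq by (cases rule: rtrancl.cases) auto
      have agree: "cut J K C x y = K x y" if xy: "(x, y) \<in> \<Omega>" for x y
      proof -
        have I: "x \<in> I" "y \<in> I" using xy \<Omega>(1) by auto
        have "x \<in> J \<or> y \<in> J" if "(x \<in> C) \<noteq> (y \<in> C)"
          using that step[of x y] step[of y x] xy \<Omega>(2)[OF xy] CJ by blast
        then show ?thesis
          using screened_reproducing[OF cov J I(1)] screened_reproducing[OF cov J I(2)]
            screened_sym[OF cov J I] covariance_on_sym[OF cov I]
          by (auto simp: cut_def)
      qed
      have "is_completion I \<Omega> K\<^sub>\<Omega> (cut J K C)"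
        using compl covariance_on_cut[OF cov J] agree by (auto simp: is_completion_def)
      then have "cut J K C s t = K s t" using s t by (rule uniq)
      moreover have "s \<in> C" "t \<notin> C"
        using separates_components[OF sep 3] by (auto simp: C_def)
      ultimately show ?thesis by (simp add: cut_def)
    qed
  qed
  then show ?thesis
    using compl cov unfolding is_canonical_completion_def canonical_covariances_def screened_def
    by blast
qed

end
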